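(* Let $f_0:[0,\infty)\to(0,\infty)$ be the solution of the initial value problem $f_0''(x)=\dfrac{1}{f_0(x)}$, $x\ge 0$, with $f_0(0)=1$ and $f_0'(0)=0$. Then, as $x\to\infty$, $$f_0(x)=z\,(\ln z)^{1/2}\left[1+\mathcal{O}\left(\frac{\ln(\ln z)}{\ln z}\right)\right],\qquad\text{where } z=x\sqrt{2}.$$ *)

theory Defs
  imports Complex_Main "HOL-Library.Landau_Symbols"
begin

text \<open>
  The solution is a function on the half-line, modelled as a total function of which only the
  values on \<^term>\<open>{0..} :: real set\<close> are constrained. Derivatives are taken within that
  half-line, so they are one-sided at 0.
\<close>

definition solves_ivp :: "(real \<Rightarrow> real) \<Rightarrow> bool" where
  "solves_ivp f \<longleftrightarrow>
     (\<forall>x\<ge>0. f x > 0) \<and>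
     (\<exists>f'. (\<forall>x\<ge>0. (f has_real_derivative f' x) (at x within {0..})) \<and>
           (\<forall>x\<ge>0. (f' has_real_derivative 1 / f x) (at x within {0..})) \<and>
           f 0 = 1 \<and> f' 0 = 0)"

end

theory Submission
  imports Defs "HOL-Analysis.Derivative" "HOL-Real_Asymp.Real_Asymp"
begin

text \<open>
  Multiplying the equation by \<open>f'\<close> and integrating gives the first integral
  \<open>f'\<^sup>2 = 2 ln f\<close>. Differentiating \<open>f / f'\<close> and \<open>f / f' + 2 f / f'\<^sup>3\<close> and eliminating
  \<open>f''\<close>, one obtains \<open>1 - 1 / f'\<^sup>2\<close> and \<open>1 + 1 / f'\<^sup>2 - 6 / f'\<^sup>4\<close>. The former is at most 1 and the
  latter eventually at least 1, so, with \<open>L = ln f\<close> and \<open>u = f / sqrt L\<close>, both \<open>u - z\<close> is bounded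
  above and \<open>u (1 + 1 / L) - z\<close> is bounded below. Taking logarithms gives
  \<open>L = ln z + O(ln (ln z))\<close>, and substituting this into \<open>f = u sqrt L\<close> yields the claim.
\<close>

section \<open>Elementary estimates for quantities close to 1\<close>

lemma abs_sqrt_minus_1_le:
  fixes y :: real
  assumes "0 \<le> y"
  shows "\<bar>sqrt y - 1\<bar> \<le> \<bar>y - 1\<bar>"
proof -
  have "y - 1 = (sqrt y - 1) * (sqrt y + 1)"
    using assms by (simp add: algebra_simps)
  then have "\<bar>y - 1\<bar> = \<bar>sqrt y - 1\<bar> * (sqrt y + 1)"
    using assms by (simp add: abs_mult)
  moreover have "\<bar>sqrt y - 1\<bar> * 1 \<le> \<bar>sqrt y - 1\<bar> * (sqrt y + 1)"
    using assms by (intro mult_left_mono) auto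
  ultimately show ?thesis by simp
qed

text \<open>Combines the relative errors of two factors. The condition \<open>d \<le> 1\<close>
  gives \<open>\<bar>b\<bar> \<le> 2\<close>, which is where the factor 2 before \<open>e\<close>
  comes from.\<close>

lemma abs_mult_minus_1_le:
  fixes a b e d :: real
  assumes "\<bar>a - 1\<bar> \<le> e" and "\<bar>b - 1\<bar> \<le> d" and "d \<le> 1"
  shows "\<bar>a * b - 1\<bar> \<le> 2 * e + d"
proof -
  have "\<bar>a * b - 1\<bar> = \<bar>(a - 1) * b + (b - 1)\<bar>" by (simp add: algebra_simps)
  also have "\<dots> \<le> \<bar>a - 1\<bar> * \<bar>b\<bar> + \<bar>b - 1\<bar>"
    by (metis abs_mult abs_triangle_ineq)
  also have "\<dots> \<le> e * 2 + d"
    using assms by (intro add_mono mult_mono) auto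
  finally show ?thesis by simp
qed

section \<open>First integral, monotonicity and growth of the solution\<close>

locale ivp_solution =
  fixes f g :: "real \<Rightarrow> real"
  assumes f_pos: "x \<ge> 0 \<Longrightarrow> f x > 0"
    and f_deriv: "x \<ge> 0 \<Longrightarrow> (f has_real_derivative g x) (at x within {0..})"
    and g_deriv: "x \<ge> 0 \<Longrightarrow> (g has_real_derivative 1 / f x) (at x within {0..})"
    and f_0: "f 0 = 1"
    and g_0: "g 0 = 0"
begin

lemma f_DERIV: "x > 0 \<Longrightarrow> (f has_real_derivative g x) (at x)"
  using DERIV_subset[OF f_deriv, of x "{0<..}"] at_within_open[of x "{0<..}"]
  by (simp add: subset_iff)

lemma g_DERIV: "x > 0 \<Longrightarrow> (g has_real_derivative 1 / f x) (at x)"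
  using DERIV_subset[OF g_deriv, of x "{0<..}"] at_within_open[of x "{0<..}"]
  by (simp add: subset_iff)

lemma first_integral:
  assumes "x \<ge> 0"
  shows "(g x)\<^sup>2 = 2 * ln (f x)"
proof -
  have "((\<lambda>x. (g x)\<^sup>2 - 2 * ln (f x)) has_real_derivative 0) (at x within {0..})" if "x \<in> {0..}" for x
    using that f_pos[of x]
    by (auto intro!: derivative_eq_intros f_deriv g_deriv simp: field_simps)
  then have "\<exists>c. \<forall>x\<in>{0..}. (g x)\<^sup>2 - 2 * ln (f x) = c"
    by (intro has_field_derivative_zero_constant) auto
  then obtain c where "\<And>x. x \<ge> 0 \<Longrightarrow> (g x)\<^sup>2 - 2 * ln (f x) = c"
    by auto
  from this[of x] this[of 0] assms show ?thesis by (simp add: f_0 g_0)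
qed

lemma g_strict_mono:
  assumes "0 \<le> x" "x < y"
  shows "g x < g y"
\<comment> \<open>The case \<open>x = 0\<close> is allowed, where only a one-sided derivative is
  known; hence a rule that needs the derivative in the open interval and mere continuity at the
  endpoints.\<close>
proof (rule DERIV_pos_imp_increasing_open[OF assms(2)])
  show "\<exists>d. (g has_real_derivative d) (at t) \<and> d > 0" if "x < t" "t < y" for t
    using g_DERIV[of t] f_pos[of t] that assms by fastforce
  have "continuous_on {0..} g"
    by (rule DERIV_continuous_on) (use g_deriv in auto)
  then show "continuous_on {x..y} g"
    by (rule continuous_on_subset) (use assms in auto)
qed

lemma g_pos: "x > 0 \<Longrightarrow> g x > 0"
  using g_strict_mono[of 0 x] by (simp add: g_0)

text \<open>By convexity \<open>f\<close> lies above its tangent at 1. The tangent at 0 is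
  horizontal and would not force growth.\<close>

lemma f_linear_lower_bound:
  assumes "x \<ge> 1"
  shows "f x \<ge> g 1 * (x - 1)"
proof -
  have "f 1 - g 1 * 1 \<le> f x - g 1 * x"
  proof (rule DERIV_nonneg_imp_nondecreasing[OF assms])
    fix t :: real assume t: "1 \<le> t" "t \<le> x"
    have "((\<lambda>t. f t - g 1 * t) has_real_derivative g t - g 1) (at t)"
      using t by (auto intro!: derivative_eq_intros f_DERIV)
    moreover have "g t - g 1 \<ge> 0"
      using g_strict_mono[of 1 t] t by (cases "t = 1") auto
    ultimately show "\<exists>d. ((\<lambda>t. f t - g 1 * t) has_real_derivative d) (at t) \<and> 0 \<le> d"
      by blast
  qed
  then show ?thesis using f_pos[of 1] by (simp add: algebra_simps)
qed

lemma f_at_top: "filterlim f at_top at_top"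
proof (rule filterlim_at_top_mono)
  show "filterlim (\<lambda>x. g 1 * (x - 1)) at_top at_top"
    using g_pos[of 1] by real_asymp
  show "\<forall>\<^sub>F x in at_top. g 1 * (x - 1) \<le> f x"
    using eventually_ge_at_top[of 1] by eventually_elim (rule f_linear_lower_bound)
qed

lemma ln_f_at_top: "filterlim (\<lambda>x. ln (f x)) at_top at_top"
  by (rule filterlim_compose[OF ln_at_top f_at_top])

lemma g_eq:
  assumes "x > 0"
  shows "g x = sqrt 2 * sqrt (ln (f x))"
proof -
  have "sqrt (2 * ln (f x)) = g x"
    using first_integral[of x] g_pos[of x] assms by (intro real_sqrt_unique) auto
  then show ?thesis by (simp add: real_sqrt_mult)
qed

section \<open>Upper and lower bounds for \<open>f / g\<close>\<close>

lemma f_over_g_upper: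
  assumes "1 \<le> x"
  shows "f x / g x \<le> x + f 1 / g 1"
proof -
  have "f x / g x - x \<le> f 1 / g 1 - 1"
  proof (rule DERIV_nonpos_imp_nonincreasing[OF assms])
    fix t :: real assume t: "1 \<le> t" "t \<le> x"
    have "((\<lambda>t. f t / g t - t) has_real_derivative - 1 / (g t)\<^sup>2) (at t)"
      using t g_pos[of t] f_pos[of t]
      by (auto intro!: derivative_eq_intros f_DERIV g_DERIV simp: field_simps power2_eq_square)
    then show "\<exists>d. ((\<lambda>t. f t / g t - t) has_real_derivative d) (at t) \<and> d \<le> 0"
      by (intro exI[of _ "- 1 / (g t)\<^sup>2"]) auto
  qed
  then show ?thesis by simp
qed

text \<open>Since \<open>(f / g)' = 1 - 1 / g\<^sup>2\<close>, the quotient alone falls behind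
  \<open>x\<close>. The term \<open>2 * f / g ^ 3\<close> contributes
  \<open>2 / g\<^sup>2 - 6 / g ^ 4\<close>, which overcompensates the loss once
  \<open>g\<^sup>2 \<ge> 6\<close>, that is, once \<open>ln f \<ge> 3\<close>.\<close>

lemma f_over_g_lower:
  obtains C where "\<forall>\<^sub>F x in at_top. x - C \<le> f x / g x * (1 + 1 / ln (f x))"
proof -
  have "\<forall>\<^sub>F x in at_top. ln (f x) \<ge> 3"
    using ln_f_at_top by (simp add: filterlim_at_top)
  then obtain X0 where X0: "\<And>x. x \<ge> X0 \<Longrightarrow> ln (f x) \<ge> 3"
    by (auto simp: eventually_at_top_linorder)
  define X where "X = max X0 1"
  let ?Q = "\<lambda>t. f t / g t + 2 * f t / g t ^ 3 - t"
  have Q_mono: "?Q X \<le> ?Q x" if "X \<le> x" for x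
  proof (rule DERIV_nonneg_imp_nondecreasing[OF that])
    fix t assume t: "X \<le> t" "t \<le> x"
    have pos: "t > 0" "g t > 0" "f t > 0"
      using t g_pos[of t] f_pos[of t] by (auto simp: X_def)
    have g2: "(g t)\<^sup>2 \<ge> 6"
      using first_integral[of t] X0[of t] t pos by (auto simp: X_def)
    have Q: "(?Q has_real_derivative 1 / (g t)\<^sup>2 - 6 / g t ^ 4) (at t)"
      using pos
      by (auto intro!: derivative_eq_intros f_DERIV g_DERIV
          simp: field_simps power2_eq_square power3_eq_cube power4_eq_xxxx)
    have "1 / (g t)\<^sup>2 - 6 / g t ^ 4 = ((g t)\<^sup>2 - 6) / g t ^ 4"
      using pos by (simp add: field_simps power2_eq_square power4_eq_xxxx)
    moreover have "\<dots> \<ge> 0"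
      using g2 pos by (intro divide_nonneg_nonneg) auto
    ultimately have "0 \<le> 1 / (g t)\<^sup>2 - 6 / g t ^ 4" by (rule ssubst)
    with Q show "\<exists>d. (?Q has_real_derivative d) (at t) \<and> 0 \<le> d"
      by (intro exI conjI)
  qed
  \<comment> \<open>The first integral turns \<open>2 / g\<^sup>2\<close> into
    \<open>1 / ln f\<close>.\<close>
  have Q_eq: "f x / g x * (1 + 1 / ln (f x)) = ?Q x + x" if "X \<le> x" for x
  proof -
    have ln: "ln (f x) = (g x)\<^sup>2 / 2" and g: "g x > 0"
      using first_integral[of x] g_pos[of x] that by (auto simp: X_def)
    show ?thesis
      unfolding ln using g by (simp add: field_simps power2_eq_square power3_eq_cube)
  qed
  have "\<forall>\<^sub>F x in at_top. x - (- ?Q X) \<le> f x / g x * (1 + 1 / ln (f x))"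
    using eventually_ge_at_top[of X]
  proof eventually_elim
    case (elim x)
    show ?case using Q_mono[OF elim] unfolding Q_eq[OF elim] by linarith
  qed
  then show thesis by (rule that)
qed

end

section \<open>From bounds on \<open>f / g\<close> to a relative error\<close>

text \<open>Here \<open>L\<close> stands for \<open>ln f\<close>, \<open>w\<close> for
  \<open>ln z\<close> and \<open>L - ln L / 2\<close> for \<open>ln u\<close>; knowing
  \<open>u\<close> up to a factor 2 suffices to compare \<open>L\<close> with
  \<open>w\<close>.\<close>

lemma log_factor_estimate:
  fixes L w :: real
  assumes L: "L \<ge> 3" and w: "w \<ge> 6"
    and lower: "w - ln 2 \<le> L - ln L / 2" and upper: "L - ln L / 2 \<le> w + ln 2"
  shows "\<bar>sqrt (L / w) - 1\<bar> \<le> 3 * (ln w / w)" and "w \<le> 2 * L"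
proof -
  have ln2: "ln (2::real) \<le> 1"
    using ln_le_minus_one[of "2::real"] by simp
  have lnL: "0 \<le> ln L" "ln L \<le> L - 1"
    using L ln_le_minus_one[of L] by auto
  show "w \<le> 2 * L" using lnL ln2 lower w by linarith
  \<comment> \<open>A crude bound is enough, as it only enters through its logarithm: it gives
    \<open>ln L \<le> 2 * ln w\<close>, so the correction \<open>ln L / 2\<close> is at most
    \<open>ln w\<close>.\<close>
  have "L \<le> 3 * w" using lnL ln2 upper w by linarith
  also have "\<dots> \<le> w * w" using w by simp
  finally have "ln L \<le> ln (w * w)" using L by (subst ln_le_cancel_iff) auto
  then have lnLw: "ln L \<le> 2 * ln w" using w by (simp add: ln_mult)
  have "ln 2 \<le> ln w" using w by simp
  then have "\<bar>L - w\<bar> \<le> 3 * ln w" using lower upper lnL lnLw by linarith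
  then have "\<bar>L / w - 1\<bar> \<le> 3 * (ln w / w)"
    using w by (simp add: divide_simps abs_if split: if_splits)
  moreover have "\<bar>sqrt (L / w) - 1\<bar> \<le> \<bar>L / w - 1\<bar>"
    using L w by (intro abs_sqrt_minus_1_le) auto
  ultimately show "\<bar>sqrt (L / w) - 1\<bar> \<le> 3 * (ln w / w)" by linarith
qed

text \<open>The quotient splits as \<open>(u / z) * sqrt (L / w)\<close>. Each factor is within
  \<open>3 * (ln w / w)\<close> of 1, and the product rule for such errors yields
  \<open>9 = 2 * 3 + 3\<close>.\<close>

lemma relative_error_bound:
  fixes u z L C :: real
  defines "w \<equiv> ln z"
  assumes L: "L \<ge> 3" and L_eq: "L = ln u + ln L / 2" and u: "u > 0"
    and upper: "u \<le> z + C" and lower: "z - C \<le> u * (1 + 1 / L)"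
    and z: "z > 0" "C / z \<le> 1 / w" "C / z \<le> 1 / 6" and w: "w \<ge> 6" "3 * (ln w / w) \<le> 1"
  shows "\<bar>u * sqrt L / (z * sqrt w) - 1\<bar> \<le> 9 * (ln w / w)"
proof -
  have Cz: "C \<le> z / 6" "C / z \<le> 1 / w" using z by (auto simp: field_simps)
  \<comment> \<open>First a rough comparison, \<open>z / 2 \<le> u \<le> 2 * z\<close>, to control
    \<open>L\<close>; the sharper bound on \<open>u / z\<close> below then uses
    \<open>w \<le> 2 * L\<close>.\<close>
  have "u * (1 / L) \<le> u * (1 / 3)" using L u by (intro mult_left_mono) (auto simp: field_simps)
  then have "z / 2 \<le> u" using lower Cz z by (simp add: algebra_simps)
  then have "ln (z / 2) \<le> ln u" using z by simp
  then have l: "w - ln 2 \<le> L - ln L / 2" using z L_eq by (simp add: w_def ln_div)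
  have "u \<le> z * 2" using upper Cz z by simp
  then have "ln u \<le> ln (z * 2)" using u z by simp
  then have r: "L - ln L / 2 \<le> w + ln 2" using z L_eq by (simp add: w_def ln_mult)
  note factor = log_factor_estimate[OF L w(1) l r]
  have "ln w \<ge> ln (exp 1)" using w(1) exp_le by (subst ln_le_cancel_iff) auto
  then have lnw: "1 \<le> ln w" by simp
  \<comment> \<open>Multiplying by \<open>1 - 1 / L\<close> isolates \<open>u\<close>, because
    \<open>(1 + 1 / L) * (1 - 1 / L) \<le> 1\<close>.\<close>
  have "(z - C) * (1 - 1 / L) \<le> u * (1 + 1 / L) * (1 - 1 / L)"
    using lower L by (intro mult_right_mono) (auto simp: field_simps)
  also have "\<dots> = u * (1 - 1 / L\<^sup>2)"
    using L by (simp add: field_simps power2_eq_square)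
  also have "\<dots> \<le> u" using u L by (simp add: field_simps)
  finally have "(z - C) / z * (1 - 1 / L) \<le> u / z"
    using z by (metis divide_right_mono less_eq_real_def times_divide_eq_left)
  moreover have "(z - C) / z * (1 - 1 / L) \<ge> (1 - 1 / w) * (1 - 1 / L)"
    using z L Cz by (intro mult_right_mono) (auto simp: diff_divide_distrib)
  moreover have "(1 - 1 / w) * (1 - 1 / L) \<ge> 1 - 1 / w - 1 / L"
    using w L by (simp add: field_simps)
  moreover have "1 / L \<le> 2 / w" using factor(2) L w by (simp add: field_simps)
  moreover have "u / z \<le> 1 + 1 / w"
    using divide_right_mono[OF upper, of z] z by (simp add: add_divide_distrib)
  moreover have "0 < 1 / w" "2 / w = 2 * (1 / w)" using w by auto
  ultimately have "\<bar>u / z - 1\<bar> \<le> 3 * (1 / w)" by linarith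
  also have "\<dots> \<le> 3 * (ln w / w)" using lnw w by (simp add: divide_right_mono)
  finally have "\<bar>u / z - 1\<bar> \<le> 3 * (ln w / w)" .
  from abs_mult_minus_1_le[OF this factor(1) w(2)]
  show ?thesis by (simp add: real_sqrt_divide)
qed

lemma (in ivp_solution) relative_error_bigo:
  "(\<lambda>x. f x / (x * sqrt 2 * ln (x * sqrt 2) powr (1/2)) - 1)
     \<in> O[at_top](\<lambda>x. ln (ln (x * sqrt 2)) / ln (x * sqrt 2))"
proof -
  obtain B where B: "\<forall>\<^sub>F x in at_top. x - B \<le> f x / g x * (1 + 1 / ln (f x))"
    by (rule f_over_g_lower)
  \<comment> \<open>One constant serves both bounds; \<open>sqrt 2\<close> comes from rescaling
    \<open>x\<close> to \<open>z\<close> and \<open>f / g\<close> to \<open>u\<close>.\<close>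
  define C where "C = sqrt 2 * max B (f 1 / g 1)"
  have "\<forall>\<^sub>F x in at_top. ln (f x) \<ge> 3"
    using ln_f_at_top by (simp add: filterlim_at_top)
  moreover have "\<forall>\<^sub>F x in at_top. C / (x * sqrt 2) \<le> 1 / ln (x * sqrt 2)"
    by real_asymp
  moreover have "\<forall>\<^sub>F x in at_top. C / (x * sqrt 2) \<le> 1 / 6"
    by real_asymp
  moreover have "\<forall>\<^sub>F x::real in at_top. ln (x * sqrt 2) \<ge> 6"
    by real_asymp
  moreover have "\<forall>\<^sub>F x::real in at_top. 3 * (ln (ln (x * sqrt 2)) / ln (x * sqrt 2)) \<le> 1"
    by real_asymp
  ultimately have "\<forall>\<^sub>F x in at_top.
      \<bar>f x / (x * sqrt 2 * ln (x * sqrt 2) powr (1/2)) - 1\<bar>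
        \<le> 9 * (ln (ln (x * sqrt 2)) / ln (x * sqrt 2))"
    using B eventually_ge_at_top[of 1]
  proof eventually_elim
    case (elim x)
    define L where "L = ln (f x)"
    define u where "u = f x / sqrt L"
    have L: "L \<ge> 3" using elim by (simp add: L_def)
    have fx: "f x > 0" using elim f_pos[of x] by simp
    have u: "u > 0" "f x = u * sqrt L" using L fx by (auto simp: u_def)
    have fg: "u = sqrt 2 * (f x / g x)"
      using g_eq[of x] elim by (simp add: u_def L_def)
    have L_eq: "L = ln u + ln L / 2"
      using fx L by (simp add: u_def ln_div ln_sqrt L_def[symmetric])
    have "sqrt 2 * (f x / g x) \<le> sqrt 2 * (x + max B (f 1 / g 1))"
      using f_over_g_upper[of x] elim by (intro mult_left_mono) auto
    then have upper: "u \<le> x * sqrt 2 + C"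
      by (simp add: fg C_def algebra_simps)
    have "sqrt 2 * (x - max B (f 1 / g 1)) \<le> sqrt 2 * (f x / g x * (1 + 1 / L))"
      using elim by (intro mult_left_mono) (auto simp: L_def)
    then have lower: "x * sqrt 2 - C \<le> u * (1 + 1 / L)"
      by (simp add: fg C_def algebra_simps)
    have "\<bar>u * sqrt L / (x * sqrt 2 * sqrt (ln (x * sqrt 2))) - 1\<bar>
        \<le> 9 * (ln (ln (x * sqrt 2)) / ln (x * sqrt 2))"
      using elim by (intro relative_error_bound[OF L L_eq u(1) upper lower]) auto
    moreover have "ln (x * sqrt 2) powr (1/2) = sqrt (ln (x * sqrt 2))"
      using elim by (intro powr_half_sqrt) linarith
    ultimately show ?case by (simp only: u(2))
  qed
  moreover have "\<forall>\<^sub>F x::real in at_top. ln (ln (x * sqrt 2)) / ln (x * sqrt 2) \<ge> 0"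
    by real_asymp
  ultimately show ?thesis
  proof (intro bigoI[of _ 9], eventually_elim)
    case (elim x)
    then show ?case by (simp only: real_norm_def abs_of_nonneg)
  qed
qed

theorem theorem3p1:
  fixes f0 :: "real \<Rightarrow> real"
  assumes "solves_ivp f0"
  shows "\<exists>r \<in> O[at_top](\<lambda>x::real. ln (ln (x * sqrt 2)) / ln (x * sqrt 2)).
           \<forall>\<^sub>F x in at_top.
             (let z = x * sqrt 2 in f0 x = z * ln z powr (1/2) * (1 + r x))"
proof -
  obtain f' where "ivp_solution f0 f'"
    using assms unfolding solves_ivp_def ivp_solution_def by blast
  then interpret ivp_solution f0 f' .
  show ?thesis
  \<comment> \<open>The witness is the relative error itself, so the equation only needs a nonzero
    denominator.\<close>
  proof (rule bexI[OF _ relative_error_bigo])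
    have "\<forall>\<^sub>F x::real in at_top. x * sqrt 2 * ln (x * sqrt 2) powr (1/2) > 0"
      by real_asymp
    then show "\<forall>\<^sub>F x in at_top. let z = x * sqrt 2 in
        f0 x = z * ln z powr (1/2) * (1 + (f0 x / (x * sqrt 2 * ln (x * sqrt 2) powr (1/2)) - 1))"
      unfolding Let_def
    proof eventually_elim
      case (elim x)
      then show ?case by (metis add_diff_cancel_left' add_diff_eq less_irrefl nonzero_mult_div_cancel_left times_divide_eq_right)
    qed
  qed
qed

end
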